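(* Let $g(t)\in\mathbb C[t]$ be of degree $n\geq1$ with zero constant term, let $b\in\mathbb C$, and let $T\in\{T_1(g,b),T_2(g,b),T_3(g)\}$. Then $$T=\bigoplus_{p=0}^{n-1}U(\mathfrak h)\cdot(t^pe^g)$$ as $U(\mathfrak h)$-modules. In particular, $T$ is free of rank $n$ over $U(\mathfrak h)$, i.e. $T\in\mathcal M(n)$.
   Context: The Lie algebra $\mathfrak{sl}(2)$ over $\mathbb C$ has basis $e,f,h$ with $[h,e]=e$, $[h,f]=-f$, $[e,f]=2h$; $\mathfrak h=\mathbb Ch$, $U(\mathfrak h)=\mathbb C[h]$. $\mathcal M(n)$ is the category of $\mathfrak{sl}(2)$-modules that are free of rank $n$ over $U(\mathfrak h)$. Let $\mathcal D(1)$ be the algebra of polynomial differential operators on $\mathbb C[t]$, $\partial=d/dt$. For $b\in\mathbb C$ there are algebra homomorphisms $\Phi_1,\Phi_2,\Phi_3:U(\mathfrak{sl}(2))\to\mathcal D(1)$ given by - $\Phi_1$: $e\mapsto t^2\partial+2bt$, $f\mapsto-\partial$, $h\mapsto t\partial+b$; - $\Phi_2$: $e\mapsto-t\partial^2+(2b-2)\partial$, $f\mapsto t$, $h\mapsto-t\partial+(b-1)$; - $\Phi_3$: $e\mapsto\tfrac12t^2$, $f\mapsto-\tfrac12\partial^2$, $h\mapsto\tfrac12t\partial+\tfrac14$. For $g\in\mathbb C[t]$, $\mathcal D(1)$ acts naturally on $\mathbb C[t]e^g$, with $\partial(pe^g)=(p'+pg')e^g$. $T_1(g,b)$, $T_2(g,b)$,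 $T_3(g)$ denote the space $\mathbb C[t]e^g$ regarded as an $\mathfrak{sl}(2)$-module via $\Phi_1,\Phi_2,\Phi_3$, respectively. *)

theory Defs
  imports "HOL-Analysis.Analysis" "HOL-Computational_Algebra.Polynomial"
begin

section \<open>The Lie algebra sl(2) and its modules\<close>

definition sl2 :: "(complex^2^2) set" where
  "sl2 = {A. trace A = 0}"

definition lie_bracket :: "complex^2^2 \<Rightarrow> complex^2^2 \<Rightarrow> complex^2^2" where
  "lie_bracket A B = A ** B - B ** A"

definition cmat_scale :: "complex \<Rightarrow> complex^2^2 \<Rightarrow> complex^2^2" where
  "cmat_scale c A = (\<chi> i j. c * A $ i $ j)"

text \<open>The element \<open>h\<close> is half of the usual Cartan generator, so that
  \<open>[h,e] = e\<close>, \<open>[h,f] = -f\<close> and \<open>[e,f] = 2h\<close>.\<close>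

definition sl2_e :: "complex^2^2" where
  "sl2_e = vector [vector [0, 1], vector [0, 0]]"

definition sl2_f :: "complex^2^2" where
  "sl2_f = vector [vector [0, 0], vector [1, 0]]"

definition sl2_h :: "complex^2^2" where
  "sl2_h = vector [vector [1/2, 0], vector [0, -1/2]]"

lemma sl2_basis_in_sl2: "sl2_e \<in> sl2" "sl2_f \<in> sl2" "sl2_h \<in> sl2"
  by (simp_all add: sl2_def trace_def sum_2 sl2_e_def sl2_f_def sl2_h_def)

lemma sl2_basis_brackets:
  "lie_bracket sl2_h sl2_e = sl2_e"
  "lie_bracket sl2_h sl2_f = - sl2_f"
  "lie_bracket sl2_e sl2_f = cmat_scale 2 sl2_h"
  by (simp_all add: lie_bracket_def cmat_scale_def sl2_e_def sl2_f_def sl2_h_def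
      matrix_matrix_mult_def vec_eq_iff forall_2 sum_2)

lemma sl2_coordinates:
  assumes "A \<in> sl2"
  shows "A = cmat_scale (A $ 1 $ 2) sl2_e + cmat_scale (A $ 2 $ 1) sl2_f
           + cmat_scale (2 * A $ 1 $ 1) sl2_h"
  using assms
  by (simp add: sl2_def trace_def sum_2 cmat_scale_def sl2_e_def sl2_f_def sl2_h_def
      vec_eq_iff forall_2 add_eq_0_iff)

locale sl2_module = vector_space smul
  for smul :: "complex \<Rightarrow> 'v::ab_group_add \<Rightarrow> 'v" +
  fixes act :: "complex^2^2 \<Rightarrow> 'v \<Rightarrow> 'v"
  assumes act_linear: "A \<in> sl2 \<Longrightarrow> Vector_Spaces.linear smul smul (act A)"
    and act_add: "A \<in> sl2 \<Longrightarrow> B \<in> sl2 \<Longrightarrow> act (A + B) v = act A v + act B v"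
    and act_scale: "A \<in> sl2 \<Longrightarrow> act (cmat_scale c A) v = smul c (act A v)"
    and act_bracket: "A \<in> sl2 \<Longrightarrow> B \<in> sl2 \<Longrightarrow>
          act (lie_bracket A B) v = act A (act B v) - act B (act A v)"


section \<open>Modules over U(h) = C[h], free modules, and the category M(n)\<close>

text \<open>The indeterminate of \<^typ>\<open>complex poly\<close> plays the role of \<open>h\<close>.\<close>

definition Uh_scale ::
  "(complex \<Rightarrow> 'v \<Rightarrow> 'v) \<Rightarrow> (complex^2^2 \<Rightarrow> 'v \<Rightarrow> 'v) \<Rightarrow>
   complex poly \<Rightarrow> 'v::ab_group_add \<Rightarrow> 'v" where
  "Uh_scale smul act u v = (\<Sum>i\<le>degree u. smul (coeff u i) ((act sl2_h ^^ i) v))"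

definition free_of_rank :: "('r::comm_ring_1 \<Rightarrow> 'v::ab_group_add \<Rightarrow> 'v) \<Rightarrow> nat \<Rightarrow> bool" where
  "free_of_rank smul n \<longleftrightarrow> module smul \<and>
     (\<exists>B. finite B \<and> card B = n \<and> \<not> module.dependent smul B \<and> module.span smul B = UNIV)"

definition in_M ::
  "nat \<Rightarrow> (complex \<Rightarrow> 'v \<Rightarrow> 'v) \<Rightarrow> (complex^2^2 \<Rightarrow> 'v::ab_group_add \<Rightarrow> 'v) \<Rightarrow> bool" where
  "in_M n smul act \<longleftrightarrow> sl2_module smul act \<and> free_of_rank (Uh_scale smul act) n"

definition cyclic_submodule :: "('r::comm_ring_1 \<Rightarrow> 'v::ab_group_add \<Rightarrow> 'v) \<Rightarrow> 'v \<Rightarrow> 'v set" where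
  "cyclic_submodule smul v = range (\<lambda>u. smul u v)"

definition is_direct_sum ::
  "('r::comm_ring_1 \<Rightarrow> 'v::ab_group_add \<Rightarrow> 'v) \<Rightarrow> 'i set \<Rightarrow> ('i \<Rightarrow> 'v set) \<Rightarrow> bool" where
  "is_direct_sum smul I N \<longleftrightarrow> module smul \<and> finite I \<and>
     (\<forall>i\<in>I. module.subspace smul (N i)) \<and>
     (\<forall>v. \<exists>!w. w \<in> (\<Pi>\<^sub>E i\<in>I. N i) \<and> v = (\<Sum>i\<in>I. w i))"


section \<open>Polynomial differential operators acting on C[t] exp(g)\<close>

text \<open>An element \<open>a\<^sub>0(t) + a\<^sub>1(t) \<partial> + \<dots> + a\<^sub>k(t) \<partial>\<^sup>k\<close> of the algebra \<open>D(1)\<close> is represented by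
  its coefficients in this normal form, i.e. by the polynomial in \<open>\<partial>\<close> (with left coefficients in
  \<open>C[t]\<close>) \<open>[:a\<^sub>0, a\<^sub>1, \<dots>, a\<^sub>k:]\<close>. Only the additive and left \<open>C[t]\<close>-linear structure of this type is
  that of \<open>D(1)\<close>: the commutative product of \<^typ>\<open>complex poly poly\<close> is not composition of
  operators and must not be used for it.\<close>

type_synonym diff_op = "complex poly poly"

text \<open>The element \<open>p exp(g)\<close> of \<open>C[t] exp(g)\<close> is represented by the polynomial \<open>p\<close>.\<close>

definition twisted_deriv :: "complex poly \<Rightarrow> complex poly \<Rightarrow> complex poly" where
  "twisted_deriv g p = pderiv p + p * pderiv g"

definition diff_op_act :: "complex poly \<Rightarrow> diff_op \<Rightarrow> complex poly \<Rightarrow> complex poly" where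
  "diff_op_act g P p = (\<Sum>i\<le>degree P. coeff P i * (twisted_deriv g ^^ i) p)"

text \<open>Sanity check: under \<open>p \<mapsto> p exp(g)\<close> this is the action on actual functions.\<close>

lemma deriv_poly_exp:
  "(deriv ^^ i) (\<lambda>t. poly p t * exp (poly g t))
     = (\<lambda>t. poly ((twisted_deriv g ^^ i) p) t * exp (poly g t))"
proof (induction i)
  case (Suc i)
  have "deriv (\<lambda>t. poly q t * exp (poly g t))
          = (\<lambda>t. poly (twisted_deriv g q) t * exp (poly g t))" for q
    by (rule ext, rule DERIV_imp_deriv)
       (auto intro!: derivative_eq_intros simp: twisted_deriv_def algebra_simps)
  then show ?case using Suc by simp
qed simp

lemma diff_op_act_poly_exp:
  "(\<Sum>i\<le>degree P. poly (coeff P i) t * (deriv ^^ i) (\<lambda>t. poly p t * exp (poly g t)) t)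
     = poly (diff_op_act g P p) t * exp (poly g t)"
  by (simp add: deriv_poly_exp diff_op_act_def poly_sum sum_distrib_right mult.assoc)


section \<open>The homomorphisms and the modules\<close>

text \<open>The maps are given by their restrictions to \<open>sl(2)\<close>, which determine them. The linear
  extension of \<open>e \<mapsto> E\<close>, \<open>f \<mapsto> F\<close>, \<open>h \<mapsto> H\<close> uses the coordinates of \<open>sl2_coordinates\<close>.\<close>

definition sl2_lin_ext :: "diff_op \<Rightarrow> diff_op \<Rightarrow> diff_op \<Rightarrow> complex^2^2 \<Rightarrow> diff_op" where
  "sl2_lin_ext E F H A =
     smult [:A $ 1 $ 2:] E + smult [:A $ 2 $ 1:] F + smult [:2 * A $ 1 $ 1:] H"

lemma sl2_lin_ext_basis:
  "sl2_lin_ext E F H sl2_e = E" "sl2_lin_ext E F H sl2_f = F" "sl2_lin_ext E F H sl2_h = H"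
  by (simp_all add: sl2_lin_ext_def sl2_e_def sl2_f_def sl2_h_def flip: one_pCons)

definition Phi1 :: "complex \<Rightarrow> complex^2^2 \<Rightarrow> diff_op" where
  "Phi1 b = sl2_lin_ext
     [: [:0, 2 * b:], [:0, 0, 1:] :]
     [: 0, -1 :]
     [: [:b:], [:0, 1:] :]"

definition Phi2 :: "complex \<Rightarrow> complex^2^2 \<Rightarrow> diff_op" where
  "Phi2 b = sl2_lin_ext
     [: 0, [:2 * b - 2:], [:0, -1:] :]
     [: [:0, 1:] :]
     [: [:b - 1:], [:0, -1:] :]"

definition Phi3 :: "complex^2^2 \<Rightarrow> diff_op" where
  "Phi3 = sl2_lin_ext
     [: [:0, 0, 1/2:] :]
     [: 0, 0, [:-1/2:] :]
     [: [:1/4:], [:0, 1/2:] :]"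

definition T1 :: "complex poly \<Rightarrow> complex \<Rightarrow> complex^2^2 \<Rightarrow> complex poly \<Rightarrow> complex poly" where
  "T1 g b A = diff_op_act g (Phi1 b A)"

definition T2 :: "complex poly \<Rightarrow> complex \<Rightarrow> complex^2^2 \<Rightarrow> complex poly \<Rightarrow> complex poly" where
  "T2 g b A = diff_op_act g (Phi2 b A)"

definition T3 :: "complex poly \<Rightarrow> complex^2^2 \<Rightarrow> complex poly \<Rightarrow> complex poly" where
  "T3 g A = diff_op_act g (Phi3 A)"

end

theory Submission
  imports Defs
begin

text \<open>In each of the three modules \<open>h\<close> acts as \<open>c t \<partial> + d\<close> with \<open>c \<noteq> 0\<close>, where \<open>\<partial>\<close> is twisted by
  \<open>g\<close>; hence it raises the degree of a nonzero polynomial by exactly \<open>n = deg g\<close>. So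
  \<open>h\<^sup>k t\<^sup>p\<close> with \<open>p < n\<close> has degree \<open>p + k n\<close>, and division with remainder by \<open>n\<close> shows that these
  elements hit every degree exactly once.\<close>

section \<open>Modules with a finite basis\<close>

text \<open>Spanning yields a decomposition; independence, applied to the difference of two
  coefficient families, makes it unique.\<close>

lemma (in module) is_direct_sum_cyclic:
  assumes I: "finite I" and indep: "\<And>u. (\<Sum>i\<in>I. scale (u i) (x i)) = 0 \<Longrightarrow> \<forall>i\<in>I. u i = 0"
    and span: "span (x ` I) = UNIV"
  shows "is_direct_sum scale I (\<lambda>i. cyclic_submodule scale (x i))"
proof -
  let ?N = "\<lambda>i. cyclic_submodule scale (x i)"
  have sub: "subspace (?N i)" for i
    unfolding cyclic_submodule_def using span_singleton[of "x i"] by (metis subspace_span)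
  have ex: "\<exists>w. w \<in> (\<Pi>\<^sub>E i\<in>I. ?N i) \<and> v = (\<Sum>i\<in>I. w i)" for v
  proof -
    \<comment> \<open>Induction over the span builds one coefficient per index: a new summand
      \<open>scale c (x i)\<close> is absorbed by adding \<open>c\<close> at
      \<open>i\<close>.\<close>
    have "v \<in> span (\<Union>i\<in>I. {x i})" using span by (simp add: UNION_singleton_eq_range)
    then have "\<exists>u. v = (\<Sum>i\<in>I. scale (u i) (x i))"
    proof (induction rule: span_induct_alt)
      case base
      show ?case by (rule exI[of _ "\<lambda>_. 0"]) simp
    next
      case (step c y z)
      then obtain i u where i: "i \<in> I" "y = x i" and u: "z = (\<Sum>i\<in>I. scale (u i) (x i))" by blast
      have "(\<Sum>j\<in>I. scale (if j = i then c else 0) (x j)) = (\<Sum>j\<in>I. if j = i then scale c (x j) else 0)"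
        by (rule sum.cong) auto
      also have "\<dots> = scale c y" using i I by simp
      finally have "scale c y + z = (\<Sum>j\<in>I. scale ((if j = i then c else 0) + u j) (x j))"
        unfolding scale_left_distrib sum.distrib u by simp
      then show ?case by (rule exI[of _ "\<lambda>j. (if j = i then c else 0) + u j"])
    qed
    then obtain u where u: "v = (\<Sum>i\<in>I. scale (u i) (x i))" ..
    show ?thesis
      \<comment> \<open>The restriction to \<open>I\<close> is needed because members of the
        extensional product are \<open>undefined\<close> outside \<open>I\<close>.\<close>
      by (rule exI[of _ "\<lambda>i\<in>I. scale (u i) (x i)"]) (auto simp: u cyclic_submodule_def)
  qed
  have un: "w = w'" if w: "w \<in> (\<Pi>\<^sub>E i\<in>I. ?N i)" and w': "w' \<in> (\<Pi>\<^sub>E i\<in>I. ?N i)"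
    and eq: "(\<Sum>i\<in>I. w i) = (\<Sum>i\<in>I. w' i)" for w w'
  proof -
    have "\<forall>i\<in>I. \<exists>a. w i = scale a (x i)" "\<forall>i\<in>I. \<exists>a. w' i = scale a (x i)"
      using w w' by (fastforce simp: cyclic_submodule_def)+
    then obtain u u' where u: "\<forall>i\<in>I. w i = scale (u i) (x i)" "\<forall>i\<in>I. w' i = scale (u' i) (x i)"
      by metis
    have "(\<Sum>i\<in>I. scale (u i - u' i) (x i)) = (\<Sum>i\<in>I. w i) - (\<Sum>i\<in>I. w' i)"
      by (simp add: u scale_left_diff_distrib sum_subtractf)
    then have "\<forall>i\<in>I. u i - u' i = 0" using indep[of "\<lambda>i. u i - u' i"] eq by simp
    then show ?thesis using w w' u by (intro PiE_ext) auto
  qed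
  show ?thesis
    unfolding is_direct_sum_def
    using I sub ex un module_axioms by metis
qed

text \<open>Passes from a family to its set of values: injectivity keeps the cardinality and
  reindexes sums over the image.\<close>

lemma (in module) free_of_rank_family:
  assumes I: "finite I" and indep: "\<And>u. (\<Sum>i\<in>I. scale (u i) (x i)) = 0 \<Longrightarrow> \<forall>i\<in>I. u i = 0"
    and inj: "inj_on x I" and span: "span (x ` I) = UNIV"
  shows "free_of_rank scale (card I)"
proof -
  have "\<not> dependent (x ` I)"
    unfolding dependent_finite[OF finite_imageI[OF I]]
    using indep[of "\<lambda>i. u (x i)" for u] by (auto simp: sum.reindex[OF inj])
  then show ?thesis
    unfolding free_of_rank_def
    using module_axioms I span card_image[OF inj] by blast
qed

section \<open>The action of U(h)\<close>

context sl2_module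
begin

interpretation h: Vector_Spaces.linear smul smul "act sl2_h"
  using act_linear sl2_basis_in_sl2 by blast

lemma Uh_scale_altdef:
  assumes "degree u \<le> k"
  shows "Uh_scale smul act u v = (\<Sum>i\<le>k. smul (coeff u i) ((act sl2_h ^^ i) v))"
  unfolding Uh_scale_def
  using assms by (intro sum.mono_neutral_left) (auto simp: coeff_eq_0)

lemma Uh_scale_0 [simp]: "Uh_scale smul act 0 v = 0"
  by (simp add: Uh_scale_def)

text \<open>Horner's scheme for evaluating a polynomial at the operator \<open>act sl2_h\<close>; it
  lets the module laws be proved by induction on coefficients.\<close>

lemma Uh_scale_pCons:
  "Uh_scale smul act (pCons a u) v = smul a v + act sl2_h (Uh_scale smul act u v)"
proof -
  have "Uh_scale smul act (pCons a u) v
      = (\<Sum>i\<le>Suc (degree u). smul (coeff (pCons a u) i) ((act sl2_h ^^ i) v))"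
    by (rule Uh_scale_altdef) (simp add: degree_pCons_le)
  also have "\<dots> = smul a v + (\<Sum>i\<le>degree u. smul (coeff u i) (act sl2_h ((act sl2_h ^^ i) v)))"
    by (simp add: sum.atMost_Suc_shift del: sum.atMost_Suc)
  finally show ?thesis by (simp add: Uh_scale_def h.sum h.scale)
qed

lemma module_Uh_scale: "module (Uh_scale smul act)"
proof
  fix u u' :: "complex poly" and v w
  show "Uh_scale smul act u (v + w) = Uh_scale smul act u v + Uh_scale smul act u w"
    by (induction u) (simp_all add: Uh_scale_pCons h.add scale_right_distrib)
  show add_left: "Uh_scale smul act (u + u') v = Uh_scale smul act u v + Uh_scale smul act u' v"
    for u u' v
    by (induction u u' rule: poly_induct2) (simp_all add: Uh_scale_pCons h.add scale_left_distrib)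
  \<comment> \<open>Needed for multiplicativity, since \<open>pCons a u * u'\<close> splits into
    \<open>smult a u'\<close> and \<open>pCons 0 (u * u')\<close>.\<close>
  have smult: "Uh_scale smul act (Polynomial.smult a u') v = smul a (Uh_scale smul act u' v)" for a
    by (induction u') (simp_all add: Uh_scale_pCons h.scale scale_right_distrib)
  show "Uh_scale smul act u (Uh_scale smul act u' v) = Uh_scale smul act (u * u') v"
    by (induction u) (simp_all add: Uh_scale_pCons add_left smult)
  show "Uh_scale smul act 1 v = v"
    by (simp add: one_pCons Uh_scale_pCons h.zero)
qed

end

section \<open>Operators that shift the degree\<close>

text \<open>The largest degree among the nonzero summands is attained only once, so its leading
  coefficient survives in the sum.\<close>

lemma sum_distinct_degrees_eq_0D:
  fixes f :: "'i \<Rightarrow> 'a::comm_monoid_add poly"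
  assumes "finite I" "(\<Sum>i\<in>I. f i) = 0"
    and distinct: "\<And>i j. i \<in> I \<Longrightarrow> j \<in> I \<Longrightarrow> f i \<noteq> 0 \<Longrightarrow> f j \<noteq> 0 \<Longrightarrow> degree (f i) = degree (f j) \<Longrightarrow> i = j"
  shows "\<forall>i\<in>I. f i = 0"
proof (rule ccontr)
  let ?J = "{i\<in>I. f i \<noteq> 0}"
  assume "\<not> ?thesis"
  then have J: "?J \<noteq> {}" "finite ?J" using assms by auto
  define d where "d = Max ((\<lambda>i. degree (f i)) ` ?J)"
  have "d \<in> (\<lambda>i. degree (f i)) ` ?J" unfolding d_def using J by (intro Max_in) auto
  then obtain i where i: "i \<in> I" "f i \<noteq> 0" "d = degree (f i)" by auto
  have le: "degree (f j) \<le> d" if "j \<in> ?J" for j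
    unfolding d_def using J that by (intro Max_ge) auto
  have "coeff (f j) d = 0" if "j \<in> I" "j \<noteq> i" for j
  proof (cases "f j = 0")
    case False
    then have "degree (f j) < d" using le[of j] distinct[of i j] i that by fastforce
    then show ?thesis by (rule coeff_eq_0)
  qed simp
  then have "coeff (\<Sum>j\<in>I. f j) d = (\<Sum>j\<in>I. if j = i then coeff (f j) d else 0)"
    by (simp only: coeff_sum) (rule sum.cong, auto)
  then have "coeff (\<Sum>j\<in>I. f j) d = coeff (f i) d" using i assms(1) by simp
  then show False using assms(2) i by simp
qed

text \<open>Isolates the one property of \<open>h\<close> from which freeness follows, so that the
  three families are treated together.\<close>

locale degree_shift_module = sl2_module "smult :: complex \<Rightarrow> complex poly \<Rightarrow> complex poly" act
  for act :: "complex^2^2 \<Rightarrow> complex poly \<Rightarrow> complex poly" +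
  fixes n :: nat
  assumes n_pos: "n \<ge> 1"
    and h_shift: "v \<noteq> 0 \<Longrightarrow> act sl2_h v \<noteq> 0 \<and> degree (act sl2_h v) = degree v + n"
begin

sublocale Uh: module "Uh_scale smult act"
  by (rule module_Uh_scale)

text \<open>With \<open>Uh_scale_const\<close>, this turns closure of \<open>Uh.span\<close> under
  U(h) into closure under \<open>act sl2_h\<close> and complex scalars.\<close>

lemma Uh_scale_h: "Uh_scale smult act [:0, 1:] v = act sl2_h v"
  using Uh.scale_one[of v] by (simp add: Uh_scale_pCons flip: one_pCons)

lemma Uh_scale_const: "Uh_scale smult act [:c:] v = Polynomial.smult c v"
proof -
  have "act sl2_h 0 = 0"
    using Uh_scale_h[of 0] by simp
  then show ?thesis by (simp add: Uh_scale_pCons)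
qed

text \<open>In Horner form each further coefficient costs one application of \<open>h\<close>, hence
  \<open>n\<close> degrees; as \<open>n\<close> is positive, the added term \<open>smult a v\<close>
  has smaller degree and cannot cancel the top.\<close>

lemma degree_Uh_scale:
  assumes "u \<noteq> 0" "v \<noteq> 0"
  shows "Uh_scale smult act u v \<noteq> 0 \<and> degree (Uh_scale smult act u v) = degree v + n * degree u"
  using assms(1)
proof (induction u)
  case (pCons a u)
  show ?case
  proof (cases "u = 0")
    case True
    then show ?thesis using pCons assms by (simp add: Uh_scale_const)
  next
    case False
    let ?w = "act sl2_h (Uh_scale smult act u v)"
    have w: "degree ?w = degree v + n * degree u + n"
      using h_shift pCons.IH False by simp
    have "degree (Polynomial.smult a v) < degree ?w"
      using w n_pos degree_smult_le[of a v] by linarith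
    \<comment> \<open>A zero sum would make the summands negatives of each other, hence of equal
      degree.\<close>
    then have "degree (Polynomial.smult a v + ?w) = degree ?w" "Polynomial.smult a v + ?w \<noteq> 0"
      by (metis degree_add_eq_right, metis add_eq_0_iff degree_minus less_irrefl)
    then show ?thesis using False w by (simp add: Uh_scale_pCons)
  qed
qed simp

text \<open>A nonzero summand with index \<open>i\<close> has degree congruent to \<open>i\<close>
  modulo \<open>n\<close>, so distinct indices give distinct degrees.\<close>

lemma monom_independent:
  assumes "(\<Sum>i\<in>{0..n-1}. Uh_scale smult act (u i) (monom 1 i)) = 0"
  shows "\<forall>i\<in>{0..n-1}. u i = 0"
proof -
  have "\<forall>i\<in>{0..n-1}. Uh_scale smult act (u i) (monom 1 i) = 0"
  proof (rule sum_distinct_degrees_eq_0D[OF _ assms])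
    fix i j
    assume ij: "i \<in> {0..n-1}" "j \<in> {0..n-1}"
      and "Uh_scale smult act (u i) (monom 1 i) \<noteq> 0" "Uh_scale smult act (u j) (monom 1 j) \<noteq> 0"
      and eq: "degree (Uh_scale smult act (u i) (monom 1 i)) = degree (Uh_scale smult act (u j) (monom 1 j))"
    then have "u i \<noteq> 0" "u j \<noteq> 0" by auto
    then have "i + n * degree (u i) = j + n * degree (u j)"
      using eq degree_Uh_scale by (simp add: degree_monom_eq)
    then have "(i + n * degree (u i)) mod n = (j + n * degree (u j)) mod n" by simp
    then show "i = j" using ij n_pos by simp
  qed simp
  then show ?thesis
    using degree_Uh_scale by (metis monom_eq_0_iff one_neq_zero)
qed

text \<open>Strong induction on the degree: some element of the span has the same degree as
  \<open>v\<close>, and subtracting a multiple of it removes the leading term.\<close>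

lemma monom_span: "Uh.span (monom 1 ` {0..n-1}) = UNIV"
proof -
  let ?S = "Uh.span (monom 1 ` {0..n-1})"
  have "v \<in> ?S" for v
  proof (induction "degree v" arbitrary: v rule: less_induct)
    case less
    have "\<exists>w\<in>?S. w \<noteq> 0 \<and> degree w = degree v"
    proof (cases "degree v < n")
      case True
      then show ?thesis
        by (intro bexI[of _ "monom 1 (degree v)"] Uh.span_base)
           (auto simp: degree_monom_eq)
    next
      case False
      \<comment> \<open>This monomial is in the span by induction, and one application of
        \<open>h\<close> lifts it to the degree of \<open>v\<close>.\<close>
      define w :: "complex poly" where "w = monom 1 (degree v - n)"
      have w: "degree w = degree v - n" "w \<noteq> 0" by (simp_all add: w_def degree_monom_eq)
      then have "w \<in> ?S" using less[of w] n_pos False by simp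
      then have "act sl2_h w \<in> ?S" using Uh.span_scale Uh_scale_h by metis
      then show ?thesis using h_shift[of w] w False by auto
    qed
    then obtain w where w: "w \<in> ?S" "w \<noteq> 0" "degree w = degree v" by blast
    define c where "c = lead_coeff v / lead_coeff w"
    have cw: "Polynomial.smult c w \<in> ?S" using w(1) Uh.span_scale Uh_scale_const by metis
    have "v - Polynomial.smult c w \<in> ?S"
    proof (cases "degree v = 0")
      \<comment> \<open>In degree 0 the subtraction cannot lower the degree, as 0 also has degree 0;
        here the difference vanishes outright.\<close>
      case True
      then obtain a b where "v = [:a:]" "w = [:b:]" using w by (metis degree_eq_zeroE)
      then have "v - Polynomial.smult c w = 0" using w by (simp add: c_def)
      then show ?thesis by (simp add: Uh.span_zero)
    next
      case False
      have "coeff (v - Polynomial.smult c w) (degree v) = 0" using w by (simp add: c_def flip: w(3))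
      moreover have "degree (v - Polynomial.smult c w) \<le> degree v"
        using degree_smult_le[of c w] w by (intro degree_diff_le) auto
      ultimately have "degree (v - Polynomial.smult c w) < degree v"
        using False by (metis degree_0 bot_nat_0.not_eq_extremum le_neq_implies_less leading_coeff_0_iff)
      then show ?thesis by (rule less)
    qed
    then show ?case using Uh.span_add[OF _ cw] by fastforce
  qed
  then show ?thesis by blast
qed

lemma monom_direct_sum:
  "is_direct_sum (Uh_scale smult act) {0..n-1}
     (\<lambda>p. cyclic_submodule (Uh_scale smult act) (monom 1 p))"
  by (intro Uh.is_direct_sum_cyclic monom_independent monom_span) auto

lemma free_of_rank: "free_of_rank (Uh_scale smult act) n"
proof -
  have "inj_on (monom (1::complex)) {0..n-1}"
    by (rule inj_onI) (metis degree_monom_eq one_neq_zero)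
  from Uh.free_of_rank_family[OF _ monom_independent this monom_span] show ?thesis
    using n_pos by simp
qed

lemma in_M: "in_M n smult act"
  unfolding in_M_def using free_of_rank sl2_module_axioms by blast

end

section \<open>Differential operators\<close>

lemma twisted_deriv_add: "twisted_deriv g (p + q) = twisted_deriv g p + twisted_deriv g q"
  by (simp add: twisted_deriv_def pderiv_add algebra_simps)

lemma twisted_deriv_minus: "twisted_deriv g (- p) = - twisted_deriv g p"
  by (simp add: twisted_deriv_def pderiv_minus)

lemma twisted_deriv_diff: "twisted_deriv g (p - q) = twisted_deriv g p - twisted_deriv g q"
  by (simp add: twisted_deriv_def pderiv_diff algebra_simps)

lemma twisted_deriv_numeral: "twisted_deriv g (numeral k * p) = numeral k * twisted_deriv g p"
  by (simp add: twisted_deriv_def pderiv_mult algebra_simps)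

lemma twisted_deriv_smult: "twisted_deriv g (smult c p) = smult c (twisted_deriv g p)"
  by (simp add: twisted_deriv_def pderiv_smult smult_add_right)

text \<open>The Weyl relation \<partial> t = 1 + t \<partial>, with \<open>pCons 0\<close> as
  multiplication by t.\<close>

lemma twisted_deriv_pCons_0: "twisted_deriv g (pCons 0 p) = p + pCons 0 (twisted_deriv g p)"
  by (simp add: twisted_deriv_def pderiv_pCons)

lemmas twisted_deriv_simps =
  twisted_deriv_add twisted_deriv_minus twisted_deriv_diff twisted_deriv_numeral
  twisted_deriv_smult twisted_deriv_pCons_0

lemma diff_op_act_altdef:
  assumes "degree P \<le> k"
  shows "diff_op_act g P p = (\<Sum>i\<le>k. coeff P i * (twisted_deriv g ^^ i) p)"
  unfolding diff_op_act_def
  using assms by (intro sum.mono_neutral_left) (auto simp: coeff_eq_0)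

lemma diff_op_act_add_op: "diff_op_act g (P + Q) p = diff_op_act g P p + diff_op_act g Q p"
  using diff_op_act_altdef[of _ "max (degree P) (degree Q)" g p]
  by (simp add: degree_add_le sum.distrib distrib_right)

lemma diff_op_act_smult_op: "diff_op_act g (smult c P) p = c * diff_op_act g P p"
  using diff_op_act_altdef[of "smult c P" "degree P" g p]
  by (simp add: degree_smult_le diff_op_act_def sum_distrib_left mult.assoc)

lemma diff_op_act_0 [simp]: "diff_op_act g 0 p = 0"
  by (simp add: diff_op_act_def)

text \<open>Coefficients stand to the left of \<partial>, so the \<partial> that is split off acts
  on \<open>p\<close> first.\<close>

lemma diff_op_act_pCons:
  "diff_op_act g (pCons a P) p = a * p + diff_op_act g P (twisted_deriv g p)"
proof -
  have "diff_op_act g (pCons a P) p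
      = (\<Sum>i\<le>Suc (degree P). coeff (pCons a P) i * (twisted_deriv g ^^ i) p)"
    by (rule diff_op_act_altdef) (simp add: degree_pCons_le)
  also have "\<dots> = a * p + diff_op_act g P (twisted_deriv g p)"
    by (simp add: sum.atMost_Suc_shift diff_op_act_def funpow_swap1 del: sum.atMost_Suc)
  finally show ?thesis .
qed

lemma diff_op_act_add: "diff_op_act g P (p + q) = diff_op_act g P p + diff_op_act g P q"
  by (induction P arbitrary: p q)
    (simp_all add: diff_op_act_pCons twisted_deriv_add distrib_left)

lemma diff_op_act_smult: "diff_op_act g P (smult c p) = smult c (diff_op_act g P p)"
  by (induction P arbitrary: p)
    (simp_all add: diff_op_act_pCons twisted_deriv_smult smult_add_right)

text \<open>The term \<open>p * pderiv g\<close> dominates \<open>pderiv p\<close>, because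
  \<open>g\<close> is not constant.\<close>

lemma degree_twisted_deriv:
  fixes g p :: "complex poly"
  assumes "degree g \<ge> 1" "p \<noteq> 0"
  shows "twisted_deriv g p \<noteq> 0 \<and> degree (twisted_deriv g p) = degree p + degree g - 1"
proof -
  have g: "pderiv g \<noteq> 0" using assms by (simp add: pderiv_eq_0_iff)
  then have d: "degree (p * pderiv g) = degree p + degree g - 1"
    using assms by (simp add: degree_mult_eq degree_pderiv)
  show ?thesis
  proof (cases "degree p = 0")
    \<comment> \<open>Treated apart because for constant \<open>p\<close> and linear
      \<open>g\<close> both terms have degree 0 and the strict comparison fails.\<close>
    case True
    then have "pderiv p = 0" by (simp add: pderiv_eq_0_iff)
    then show ?thesis using d g assms by (simp add: twisted_deriv_def)
  next
    case False
    then have "degree (pderiv p) < degree (p * pderiv g)"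
      using d assms by (simp add: degree_pderiv)
    then have "degree (twisted_deriv g p) = degree (p * pderiv g)" "twisted_deriv g p \<noteq> 0"
      unfolding twisted_deriv_def
      by (metis degree_add_eq_right, metis add_eq_0_iff degree_minus less_irrefl)
    then show ?thesis using d by simp
  qed
qed

text \<open>The operator is c t \<partial> + d: the factor t restores the degree lost in
  \<open>degree_twisted_deriv\<close>, and the term from d stays below.\<close>

lemma degree_euler_operator:
  fixes g p :: "complex poly"
  assumes "degree g \<ge> 1" "c \<noteq> 0" "p \<noteq> 0"
  shows "diff_op_act g [:[:d:], [:0, c:]:] p \<noteq> 0
    \<and> degree (diff_op_act g [:[:d:], [:0, c:]:] p) = degree p + degree g"
proof -
  let ?q = "smult c (pCons 0 (twisted_deriv g p))"
  have eq: "diff_op_act g [:[:d:], [:0, c:]:] p = smult d p + ?q"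
    by (simp add: diff_op_act_pCons)
  have "degree ?q = degree p + degree g"
    using assms degree_twisted_deriv[of g p] by simp
  moreover from this have "degree (smult d p) < degree ?q"
    using assms degree_smult_le[of d p] by linarith
  ultimately show ?thesis
    unfolding eq by (metis degree_add_eq_right add_eq_0_iff degree_minus less_irrefl)
qed

section \<open>The three families of modules\<close>

text \<open>By bilinearity the bracket law reduces to the three relations between basis
  elements.\<close>

lemma sl2_module_lin_ext:
  fixes g :: "complex poly"
  defines "D \<equiv> diff_op_act g"
  assumes HE: "\<And>p. D H (D E p) - D E (D H p) = D E p"
    and HF: "\<And>p. D H (D F p) - D F (D H p) = - D F p"
    and EF: "\<And>p. D E (D F p) - D F (D E p) = smult 2 (D H p)"
  shows "sl2_module smult (\<lambda>A. D (sl2_lin_ext E F H A))"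
proof -
  have act: "D (sl2_lin_ext E F H A) p
      = smult (A $ 1 $ 2) (D E p) + smult (A $ 2 $ 1) (D F p) + smult (2 * A $ 1 $ 1) (D H p)" for A p
    by (simp add: D_def sl2_lin_ext_def diff_op_act_add_op diff_op_act_smult_op)
  have lins: "D X (p + q) = D X p + D X q" "D X (smult c p) = smult c (D X p)" for X c p q
    by (simp_all add: D_def diff_op_act_add diff_op_act_smult)
  have vs: "vector_space (smult :: complex \<Rightarrow> complex poly \<Rightarrow> complex poly)"
    by unfold_locales (simp_all add: smult_add_right smult_add_left)
  interpret vector_space "smult :: complex \<Rightarrow> complex poly \<Rightarrow> complex poly" by (rule vs)
  show ?thesis
  proof unfold_locales
    fix A B :: "complex^2^2" and c p q
    show "D (sl2_lin_ext E F H A) (p + q) = D (sl2_lin_ext E F H A) p + D (sl2_lin_ext E F H A) q"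
      by (simp add: act lins smult_add_right)
    show "D (sl2_lin_ext E F H A) (smult c p) = smult c (D (sl2_lin_ext E F H A) p)"
      by (simp add: act lins smult_add_right mult.commute)
    show "D (sl2_lin_ext E F H (A + B)) p = D (sl2_lin_ext E F H A) p + D (sl2_lin_ext E F H B) p"
      by (simp add: act smult_add_left distrib_left)
    show "D (sl2_lin_ext E F H (cmat_scale c A)) p = smult c (D (sl2_lin_ext E F H A) p)"
      by (simp add: act cmat_scale_def smult_add_right mult.left_commute)
    assume AB: "A \<in> sl2" "B \<in> sl2"
    then have AB: "A $ 2 $ 2 = - A $ 1 $ 1" "B $ 2 $ 2 = - B $ 1 $ 1"
      by (simp_all add: sl2_def trace_def sum_2 add_eq_0_iff)
    \<comment> \<open>Oriented as rewrite rules, the relations bring every product into the order F,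
      E, H, as in a PBW normal form.\<close>
    have HE': "D H (D E p) = D E (D H p) + D E p" using HE[of p] by (simp add: algebra_simps)
    have HF': "D H (D F p) = D F (D H p) - D F p" using HF[of p] by (simp add: algebra_simps)
    have EF': "D E (D F p) = D F (D E p) + smult 2 (D H p)" using EF[of p] by (simp add: algebra_simps)
    show "D (sl2_lin_ext E F H (lie_bracket A B)) p
        = D (sl2_lin_ext E F H A) (D (sl2_lin_ext E F H B) p)
          - D (sl2_lin_ext E F H B) (D (sl2_lin_ext E F H A) p)"
      \<comment> \<open>Comparing values at every point reduces the identity to commutative
        arithmetic in the complex numbers.\<close>
      unfolding poly_eq_poly_eq_iff[symmetric] fun_eq_iff
      by (simp add: act lins HE' HF' EF' lie_bracket_def matrix_matrix_mult_def sum_2 AB algebra_simps)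
  qed
qed

text \<open>Linearity and the Weyl relation move every \<partial> to the right, leaving identities
  in the iterated twisted derivatives of \<open>p\<close>; the same computation serves the other two
  families.\<close>

lemma sl2_module_T1: "sl2_module smult (T1 g b)"
  unfolding T1_def[abs_def] Phi1_def
  by (rule sl2_module_lin_ext)
    (simp_all add: diff_op_act_pCons twisted_deriv_simps smult_add_right smult_diff_right fun_eq_iff
      flip: poly_eq_poly_eq_iff, simp_all add: algebra_simps)

lemma sl2_module_T2: "sl2_module smult (T2 g b)"
  unfolding T2_def[abs_def] Phi2_def
  by (rule sl2_module_lin_ext)
    (simp_all add: diff_op_act_pCons twisted_deriv_simps smult_add_right smult_diff_right fun_eq_iff
      flip: poly_eq_poly_eq_iff, simp_all add: algebra_simps)

lemma sl2_module_T3: "sl2_module smult (T3 g)"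
  unfolding T3_def[abs_def] Phi3_def
  by (rule sl2_module_lin_ext)
    (simp_all add: diff_op_act_pCons twisted_deriv_simps smult_add_right smult_diff_right fun_eq_iff
      flip: poly_eq_poly_eq_iff, simp_all add: algebra_simps)

lemma T_sl2_h:
  "T1 g b sl2_h = diff_op_act g [:[:b:], [:0, 1:]:]"
  "T2 g b sl2_h = diff_op_act g [:[:b - 1:], [:0, -1:]:]"
  "T3 g sl2_h = diff_op_act g [:[:1/4:], [:0, 1/2:]:]"
  by (simp_all add: fun_eq_iff T1_def T2_def T3_def Phi1_def Phi2_def Phi3_def sl2_lin_ext_basis)

theorem proposition6p6:
  fixes g :: "complex poly" and b :: complex and n :: nat
    and T :: "complex^2^2 \<Rightarrow> complex poly \<Rightarrow> complex poly"
  assumes "degree g = n" and "n \<ge> 1" and "coeff g 0 = 0"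
    and "T \<in> {T1 g b, T2 g b, T3 g}"
  shows "is_direct_sum (Uh_scale smult T) {0..n - 1}
             (\<lambda>p. cyclic_submodule (Uh_scale smult T) (monom 1 p))
         \<and> free_of_rank (Uh_scale smult T) n
         \<and> in_M n smult T"
proof -
  \<comment> \<open>The values of \<open>c\<close> are 1, -1 and 1/2, those of \<open>d\<close> are
    \<open>b\<close>, \<open>b - 1\<close> and 1/4.\<close>
  have "\<exists>c d. c \<noteq> 0 \<and> T sl2_h = diff_op_act g [:[:d:], [:0, c:]:]"
    using assms(4) T_sl2_h
    by (metis insertE singletonD neg_equal_0_iff_equal one_neq_zero zero_neq_numeral divide_eq_0_iff)
  then obtain c d where cd: "c \<noteq> 0" "T sl2_h = diff_op_act g [:[:d:], [:0, c:]:]" by blast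
  have "sl2_module smult T"
    using assms(4) sl2_module_T1 sl2_module_T2 sl2_module_T3 by blast
  then interpret sl2_module smult T .
  interpret degree_shift_module T n
    by unfold_locales (use assms cd degree_euler_operator in auto)
  show ?thesis using monom_direct_sum free_of_rank in_M by blast
qed

end
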